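(* Let $(X,\mu)$ be a non-atomic Lebesgue space with a positive finite or $\sigma$-finite measure, and let $T:X\to X$ be nonsingular. If $(X,\mu,T)$ is doubly ergodic, then $T$ exhibits weak measurable sensitivity. In particular, every weakly mixing, finite measure-preserving transformation exhibits weak measurable sensitivity.
   Context: $T$ is nonsingular if it is measurable and, for measurable $A$, $\mu(A)=0$ if and only if $\mu(T^{-1}(A))=0$. A nonsingular $T$ is doubly ergodic if for all sets $A$ and $B$ of positive measure there exists an integer $n>0$ such that $\mu(T^{-n}(A)\cap A)>0$ and $\mu(T^{-n}(A)\cap B)>0$. A metric $d$ on a measure space is good if all nonempty open sets have positive measure; when a space carries a good metric, the measure on it is assumed to be regular (so open sets are measurable). $B_\varepsilon(x)$ denotes the open $d$-ball of radius $\varepsilon$ about $x$. Two systems $(X,\mu,T)$ and $(X_1,\mu_1,T_1)$ are measure-theoretically isomorphic if, after discarding null sets (with forward-invariant complements), there is a bimeasurable bijection between them that carries $\mu$ to $\mu_1$ and intertwines $T$ and $T_1$. $T$ exhibits weak measurable sensitivity if whenever $(X_1,\mu_1,T_1)$ is measure-theoretically isomorphic to $(X,\mu,T)$ and $d$ is a good metric on $X_1$, there exists $\delta>0$ such that for all $x\in X_1$ and all $\varepsilon>0$ there exists $n\in\mathbb{N}$ such that $\mu_1\{y\in B_\varepsilon(x): d(T_1^n(x),T_1^n(y))>\delta\}>0$. *)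

theory Defs
  imports "HOL-Analysis.Analysis"
begin

definition nonsingular :: "'a measure \<Rightarrow> ('a \<Rightarrow> 'a) \<Rightarrow> bool" where
  "nonsingular M T \<longleftrightarrow> T \<in> measurable M M \<and>
     (\<forall>A\<in>sets M. emeasure M A = 0 \<longleftrightarrow> emeasure M (T -` A \<inter> space M) = 0)"

definition doubly_ergodic :: "'a measure \<Rightarrow> ('a \<Rightarrow> 'a) \<Rightarrow> bool" where
  "doubly_ergodic M T \<longleftrightarrow> nonsingular M T \<and>
     (\<forall>A\<in>sets M. \<forall>B\<in>sets M. emeasure M A > 0 \<longrightarrow> emeasure M B > 0 \<longrightarrow>
       (\<exists>n>0. emeasure M ((T ^^ n) -` A \<inter> A) > 0 \<and> emeasure M ((T ^^ n) -` A \<inter> B) > 0))"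

definition measure_preserving_map :: "'a measure \<Rightarrow> ('a \<Rightarrow> 'a) \<Rightarrow> bool" where
  "measure_preserving_map M T \<longleftrightarrow> T \<in> measurable M M \<and>
     (\<forall>A\<in>sets M. emeasure M (T -` A \<inter> space M) = emeasure M A)"

text \<open>For a finite measure \<open>\<mu>\<close> on \<open>X\<close> that need not have total mass 1, weak mixing is the usual
  condition for the normalized measure \<open>\<mu> / \<mu>(X)\<close>, multiplied through by \<open>\<mu>(X)\<close>.\<close>

definition weakly_mixing :: "'a measure \<Rightarrow> ('a \<Rightarrow> 'a) \<Rightarrow> bool" where
  "weakly_mixing M T \<longleftrightarrow>
     (\<forall>A\<in>sets M. \<forall>B\<in>sets M.
       (\<lambda>n. (\<Sum>i<n. \<bar>measure M ((T ^^ i) -` A \<inter> B)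
                      - measure M A * measure M B / measure M (space M)\<bar>) / real n)
         \<longlonglongrightarrow> 0)"

definition measure_iso_on ::
    "'a measure \<Rightarrow> 'b measure \<Rightarrow> 'a set \<Rightarrow> 'b set \<Rightarrow> ('a \<Rightarrow> 'b) \<Rightarrow> bool" where
  "measure_iso_on M N Y Z \<phi> \<longleftrightarrow>
     Y \<in> sets M \<and> emeasure M (space M - Y) = 0 \<and>
     Z \<in> sets N \<and> emeasure N (space N - Z) = 0 \<and>
     bij_betw \<phi> Y Z \<and>
     \<phi> \<in> measurable (restrict_space M Y) (restrict_space N Z) \<and>
     the_inv_into Y \<phi> \<in> measurable (restrict_space N Z) (restrict_space M Y) \<and>
     (\<forall>A\<in>sets N. A \<subseteq> Z \<longrightarrow> emeasure M (\<phi> -` A \<inter> Y) = emeasure N A)"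

definition isomorphic_systems ::
    "'a measure \<Rightarrow> ('a \<Rightarrow> 'a) \<Rightarrow> 'b measure \<Rightarrow> ('b \<Rightarrow> 'b) \<Rightarrow> bool" where
  "isomorphic_systems M T N S \<longleftrightarrow>
     T \<in> measurable M M \<and> S \<in> measurable N N \<and>
     (\<exists>Y Z \<phi>. measure_iso_on M N Y Z \<phi> \<and> T ` Y \<subseteq> Y \<and> S ` Z \<subseteq> Z \<and>
        (\<forall>x\<in>Y. \<phi> (T x) = S (\<phi> x)))"

text \<open>A Lebesgue space is a complete measure space which, modulo null sets, consists of a (bounded
  or unbounded, possibly empty) real interval with Lebesgue measure together with countably many
  point masses.\<close>

definition lebesgue_space :: "'a measure \<Rightarrow> bool" where
  "lebesgue_space M \<longleftrightarrow> complete_measure M \<and>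
     (\<exists>D. countable D \<and> D \<subseteq> space M \<and>
        (\<forall>x\<in>D. {x} \<in> sets M \<and> 0 < emeasure M {x} \<and> emeasure M {x} < \<infinity>) \<and>
        (\<exists>(I :: real set) Y Z \<phi>. is_interval I \<and>
           measure_iso_on (restrict_space M (space M - D)) (lebesgue_on I) Y Z \<phi>))"

definition non_atomic :: "'a measure \<Rightarrow> bool" where
  "non_atomic M \<longleftrightarrow>
     (\<forall>A\<in>sets M. emeasure M A > 0 \<longrightarrow>
       (\<exists>B\<in>sets M. B \<subseteq> A \<and> 0 < emeasure M B \<and> emeasure M B < emeasure M A))"

text \<open>Regularity with respect to the topology of the metric \<open>d\<close>: open sets are measurable, and
  measurable sets are approximated by open sets from outside and by closed sets from inside.
  Inner approximation by compact sets would be a stronger requirement.\<close>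

definition regular_for_metric :: "'a measure \<Rightarrow> ('a \<Rightarrow> 'a \<Rightarrow> real) \<Rightarrow> bool" where
  "regular_for_metric M d \<longleftrightarrow>
     (\<forall>U. openin (Metric_space.mtopology (space M) d) U \<longrightarrow> U \<in> sets M) \<and>
     (\<forall>A\<in>sets M.
        emeasure M A
          = (INF U\<in>{U. openin (Metric_space.mtopology (space M) d) U \<and> A \<subseteq> U}. emeasure M U) \<and>
        emeasure M A
          = (SUP F\<in>{F. closedin (Metric_space.mtopology (space M) d) F \<and> F \<subseteq> A}. emeasure M F))"

definition good_metric :: "'a measure \<Rightarrow> ('a \<Rightarrow> 'a \<Rightarrow> real) \<Rightarrow> bool" where
  "good_metric M d \<longleftrightarrow> Metric_space (space M) d \<and> regular_for_metric M d \<and>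
     (\<forall>U. openin (Metric_space.mtopology (space M) d) U \<longrightarrow> U \<noteq> {} \<longrightarrow> emeasure M U > 0)"

text \<open>A formula of HOL cannot quantify over types, so the type carrying the isomorphic copies
  is a parameter; a theorem with this type left as a type variable covers copies on all types.\<close>

definition weak_measurable_sensitivity ::
    "'b itself \<Rightarrow> 'a measure \<Rightarrow> ('a \<Rightarrow> 'a) \<Rightarrow> bool" where
  "weak_measurable_sensitivity TYPE('b) M T \<longleftrightarrow>
     (\<forall>(N :: 'b measure) S d. isomorphic_systems M T N S \<longrightarrow> good_metric N d \<longrightarrow>
       (\<exists>\<delta>>0. \<forall>x\<in>space N. \<forall>\<epsilon>>0. \<exists>n::nat.
          emeasure N {y \<in> Metric_space.mball (space N) d x \<epsilon>. d ((S ^^ n) x) ((S ^^ n) y) > \<delta>} > 0))"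

end

(* For points x, p at distance at least 5 delta, let B be a small ball about x and C the delta-ball
   about p. If some time n sends a positive part of B into B and a positive part of B into C, then
   S^n x cannot be delta-close to both parts. The existence of such an n (with a common source B
   instead of the common target in the definition of double ergodicity) follows by choosing m with
   E = B \<inter> T^-m C positive and applying double ergodicity to E and T^-m B. *)
theory Submission
  imports Defs
begin

text \<open>Induction on \<open>m\<close>, peeling one \<open>T\<close> off the iterate. One
  direction makes a pulled-back set positive, the other cancels a power of \<open>T\<close> from a
  positive preimage.\<close>

lemma nonsingular_funpow_pos_iff:
  assumes "nonsingular M T" "A \<in> sets M"
  shows "emeasure M ((T ^^ m) -` A \<inter> space M) > 0 \<longleftrightarrow> emeasure M A > 0"
proof (induction m)
  case 0
  then show ?case using assms(2) by (simp add: Int_absorb2 sets.sets_into_space)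
next
  case (Suc m)
  have T: "T \<in> measurable M M" using assms(1) by (simp add: nonsingular_def)
  have meas: "(T ^^ m) -` A \<inter> space M \<in> sets M"
    using measurable_sets[OF measurable_compose_n[OF T] assms(2)] .
  have "(T ^^ Suc m) -` A \<inter> space M = T -` ((T ^^ m) -` A \<inter> space M) \<inter> space M"
    using measurable_space[OF T] by (auto simp: funpow_swap1)
  with Suc meas assms(1) show ?case by (metis nonsingular_def not_gr_zero)
qed

text \<open>A return from \<open>E\<close> to \<open>E\<close> is in particular a return from
  \<open>B\<close> to \<open>B\<close>. If \<open>(T ^^ m) y\<close> lies in \<open>B\<close> and
  \<open>(T ^^ n) y\<close> in \<open>E\<close>, then, since the iterates commute, time
  \<open>n\<close> moves the point \<open>(T ^^ m) y\<close> of \<open>B\<close> into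
  \<open>C\<close>.\<close>

lemma doubly_ergodic_common_source:
  assumes de: "doubly_ergodic M T" and B: "B \<in> sets M" and C: "C \<in> sets M"
    and posB: "emeasure M B > 0" and posC: "emeasure M C > 0"
  obtains n where "emeasure M ((T ^^ n) -` B \<inter> B) > 0" "emeasure M ((T ^^ n) -` C \<inter> B) > 0"
proof -
  have ns: "nonsingular M T" and
    de': "\<And>A B. \<lbrakk>A \<in> sets M; B \<in> sets M; emeasure M A > 0; emeasure M B > 0\<rbrakk> \<Longrightarrow>
      \<exists>n>0. emeasure M ((T ^^ n) -` A \<inter> A) > 0 \<and> emeasure M ((T ^^ n) -` A \<inter> B) > 0"
    using de by (auto simp: doubly_ergodic_def)
  have T: "T \<in> measurable M M" using ns by (simp add: nonsingular_def)
  have meas: "(T ^^ k) -` A \<inter> D \<in> sets M" if "A \<in> sets M" "D \<in> sets M" for k A D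
  proof -
    have "(T ^^ k) -` A \<inter> D = ((T ^^ k) -` A \<inter> space M) \<inter> D"
      using sets.sets_into_space[OF that(2)] by auto
    then show ?thesis
      using measurable_sets[OF measurable_compose_n[OF T] that(1)] that(2) by auto
  qed
  \<comment> \<open>Here \<open>C\<close> is the common target, and only the passage from
    \<open>B\<close> to \<open>C\<close> is kept; it makes \<open>E\<close> positive.\<close>
  obtain m where m: "emeasure M ((T ^^ m) -` C \<inter> B) > 0"
    using de'[OF C B posC posB] by blast
  define E where "E = (T ^^ m) -` C \<inter> B"
  define F where "F = (T ^^ m) -` B \<inter> space M"
  have E: "E \<in> sets M" and F: "F \<in> sets M"
    unfolding E_def F_def using B C by (auto intro: meas)
  have posF: "emeasure M F > 0"
    using nonsingular_funpow_pos_iff[OF ns B] posB by (simp add: F_def)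
  obtain n where n: "emeasure M ((T ^^ n) -` E \<inter> E) > 0" "emeasure M ((T ^^ n) -` E \<inter> F) > 0"
    using de'[OF E F _ posF] m unfolding E_def by blast
  show ?thesis
  proof
    have "emeasure M ((T ^^ n) -` E \<inter> E) \<le> emeasure M ((T ^^ n) -` B \<inter> B)"
      using B by (intro emeasure_mono meas) (auto simp: E_def)
    with n(1) show "emeasure M ((T ^^ n) -` B \<inter> B) > 0" by (rule less_le_trans)
    have comm: "(T ^^ n) ((T ^^ m) y) = (T ^^ m) ((T ^^ n) y)" for y
      by (metis add.commute comp_apply funpow_add)
    \<comment> \<open>The passage is first seen only after pulling back by \<open>T ^^ m\<close>;
      nonsingularity then removes this pullback.\<close>
    have "emeasure M ((T ^^ n) -` E \<inter> F)
        \<le> emeasure M ((T ^^ m) -` ((T ^^ n) -` C \<inter> B) \<inter> space M)"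
      using B C by (intro emeasure_mono meas) (auto simp: E_def F_def comm)
    with n(2) have "emeasure M ((T ^^ m) -` ((T ^^ n) -` C \<inter> B) \<inter> space M) > 0"
      by (rule less_le_trans)
    then show "emeasure M ((T ^^ n) -` C \<inter> B) > 0"
      by (rule nonsingular_funpow_pos_iff[OF ns meas[OF C B], THEN iffD1])
  qed
qed

text \<open>Both sets are pulled back along \<phi>, the common-source property is applied in
  \<open>M\<close>, and the resulting positive measures are read off in \<open>N\<close>. Double
  ergodicity of \<open>S\<close> itself is never derived.\<close>

lemma isomorphic_common_source:
  assumes de: "doubly_ergodic M T" and iso: "isomorphic_systems M T N S"
    and B: "B \<in> sets N" and C: "C \<in> sets N"
    and posB: "emeasure N B > 0" and posC: "emeasure N C > 0"
  obtains n where "emeasure N ((S ^^ n) -` B \<inter> B) > 0" "emeasure N ((S ^^ n) -` C \<inter> B) > 0"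
proof -
  obtain Y Z \<phi> where S: "S \<in> measurable N N" and mi: "measure_iso_on M N Y Z \<phi>"
    and TY: "T ` Y \<subseteq> Y" and eqv: "\<forall>x\<in>Y. \<phi> (T x) = S (\<phi> x)"
    using iso unfolding isomorphic_systems_def by blast
  have Y: "Y \<in> sets M" and Z: "Z \<in> sets N" and nullZ: "emeasure N (space N - Z) = 0"
    and bij: "bij_betw \<phi> Y Z"
    and \<phi>: "\<phi> \<in> measurable (restrict_space M Y) (restrict_space N Z)"
    and em: "\<And>A. A \<in> sets N \<Longrightarrow> A \<subseteq> Z \<Longrightarrow> emeasure M (\<phi> -` A \<inter> Y) = emeasure N A"
    using mi by (auto simp: measure_iso_on_def)
  have \<phi>Z: "\<phi> y \<in> Z" if "y \<in> Y" for y using bij that by (auto simp: bij_betw_def)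
  have pull: "\<phi> -` A \<inter> Y \<in> sets M" "emeasure M (\<phi> -` A \<inter> Y) = emeasure N (A \<inter> Z)"
    if "A \<in> sets N" for A
  proof -
    have "A \<inter> Z \<in> sets (restrict_space N Z)"
      using that Z by (simp add: sets_restrict_space_iff)
    from measurable_sets[OF \<phi> this]
    have "\<phi> -` (A \<inter> Z) \<inter> Y \<in> sets M"
      using Y sets.sets_into_space[OF Y]
      by (simp add: sets_restrict_space_iff space_restrict_space Int_absorb2)
    moreover have eq: "\<phi> -` (A \<inter> Z) \<inter> Y = \<phi> -` A \<inter> Y" using \<phi>Z by auto
    ultimately show "\<phi> -` A \<inter> Y \<in> sets M" by simp
    show "emeasure M (\<phi> -` A \<inter> Y) = emeasure N (A \<inter> Z)"
      using em[of "A \<inter> Z"] that Z unfolding eq by auto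
  qed
  have full: "emeasure N (A \<inter> Z) = emeasure N A" if "A \<in> sets N" for A
  proof -
    have "A = (A \<inter> Z) \<union> (A \<inter> (space N - Z))"
      using sets.sets_into_space[OF that] by auto
    moreover have "A \<inter> (space N - Z) \<in> null_sets N"
      using nullZ Z that by (intro null_set_Int1) auto
    ultimately show ?thesis
      using emeasure_Un_null_set[of "A \<inter> Z" N "A \<inter> (space N - Z)"] that Z by auto
  qed
  \<comment> \<open>Forward invariance of \<open>Y\<close> keeps each orbit where the intertwining
    relation holds.\<close>
  have iter: "(T ^^ k) y \<in> Y \<and> \<phi> ((T ^^ k) y) = (S ^^ k) (\<phi> y)" if "y \<in> Y" for k y
    using that TY eqv by (induction k) auto
  have push: "emeasure M ((T ^^ k) -` (\<phi> -` A \<inter> Y) \<inter> (\<phi> -` B \<inter> Y)) = emeasure N ((S ^^ k) -` A \<inter> B)"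
    if A: "A \<in> sets N" for k A
  proof -
    have "(S ^^ k) -` A \<inter> B = ((S ^^ k) -` A \<inter> space N) \<inter> B"
      using sets.sets_into_space[OF B] by auto
    then have meas: "(S ^^ k) -` A \<inter> B \<in> sets N"
      using measurable_sets[OF measurable_compose_n[OF S] A] B by auto
    have "(T ^^ k) -` (\<phi> -` A \<inter> Y) \<inter> (\<phi> -` B \<inter> Y) = \<phi> -` ((S ^^ k) -` A \<inter> B) \<inter> Y"
      using iter by auto
    then show ?thesis using pull(2)[OF meas] full[OF meas] by simp
  qed
  have pos: "emeasure M (\<phi> -` B \<inter> Y) > 0" "emeasure M (\<phi> -` C \<inter> Y) > 0"
    using pull(2) full B C posB posC by auto
  show ?thesis
    using doubly_ergodic_common_source[OF de pull(1)[OF B] pull(1)[OF C] pos] push[OF B] push[OF C]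
      that by metis
qed

text \<open>A set of intermediate measure and its complement are both positive, so both meet
  \<open>Y\<close>, and the injective \<phi> separates the points chosen there. Two distinct points
  fix the scale of \<delta> in the sensitivity proof.\<close>

lemma non_atomic_isomorphic_two_points:
  assumes na: "non_atomic M" and pos: "emeasure M (space M) > 0"
    and iso: "isomorphic_systems M T N S"
  obtains p q where "p \<in> space N" "q \<in> space N" "p \<noteq> q"
proof -
  obtain Y Z \<phi> where mi: "measure_iso_on M N Y Z \<phi>"
    using iso unfolding isomorphic_systems_def by blast
  have Y: "Y \<in> sets M" and nullY: "emeasure M (space M - Y) = 0" and Z: "Z \<in> sets N"
    and bij: "bij_betw \<phi> Y Z"
    using mi by (auto simp: measure_iso_on_def)
  obtain B where B: "B \<in> sets M" "0 < emeasure M B" "emeasure M B < emeasure M (space M)"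
    using na pos unfolding non_atomic_def by blast
  have meets: "A \<inter> Y \<noteq> {}" if "A \<in> sets M" "emeasure M A > 0" for A
  proof
    assume "A \<inter> Y = {}"
    then have "A \<subseteq> space M - Y" using sets.sets_into_space[OF that(1)] by auto
    then have "emeasure M A \<le> emeasure M (space M - Y)" using Y by (intro emeasure_mono) auto
    with nullY that(2) show False by simp
  qed
  have "emeasure M (space M - B) > 0"
  proof (rule ccontr)
    assume "\<not> ?thesis"
    \<comment> \<open>Adding rather than subtracting keeps the argument valid when the total measure
      is infinite.\<close>
    moreover have "emeasure M (space M) \<le> emeasure M B + emeasure M (space M - B)"
      using B(1) sets.sets_into_space[OF B(1)]
      by (simp add: plus_emeasure Un_absorb1)
    ultimately show False using B(3) by simp
  qed
  then obtain a b where "a \<in> B \<inter> Y" "b \<in> (space M - B) \<inter> Y"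
    using meets[OF B(1,2)] meets[of "space M - B"] B(1) by blast
  then have "\<phi> a \<in> Z" "\<phi> b \<in> Z" "\<phi> a \<noteq> \<phi> b"
    using bij by (auto simp: bij_betw_def inj_on_def)
  then show ?thesis using that sets.sets_into_space[OF Z] by blast
qed

lemma doubly_ergodic_sensitive:
  assumes de: "doubly_ergodic M T" and na: "non_atomic M" and pos: "emeasure M (space M) > 0"
  shows "weak_measurable_sensitivity TYPE('b) M T"
  unfolding weak_measurable_sensitivity_def
proof (intro allI impI)
  fix N :: "'b measure" and S d
  assume iso: "isomorphic_systems M T N S" and good: "good_metric N d"
  interpret Metric_space "space N" d using good by (simp add: good_metric_def)
  have S: "S \<in> measurable N N" using iso by (simp add: isomorphic_systems_def)
  have op: "U \<in> sets N" if "openin mtopology U" for U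
    using good that by (simp add: good_metric_def regular_for_metric_def)
  have op_pos: "emeasure N U > 0" if "openin mtopology U" "U \<noteq> {}" for U
    using good that by (simp add: good_metric_def)
  obtain p q where pq: "p \<in> space N" "q \<in> space N" "p \<noteq> q"
    using non_atomic_isomorphic_two_points[OF na pos iso] .
  \<comment> \<open>Every point is at distance at least \<open>d p q / 2\<close>, that is
    \<open>5 * \<delta>\<close>, from \<open>p\<close> or from \<open>q\<close>, so this \<delta>
    serves all \<open>x\<close> at once; \<open>c\<close> below is the farther choice.\<close>
  define \<delta> where "\<delta> = d p q / 10"
  have \<delta>: "\<delta> > 0" using pq by (simp add: \<delta>_def mdist_pos_less)
  show "\<exists>\<delta>>0. \<forall>x\<in>space N. \<forall>\<epsilon>>0. \<exists>n. emeasure N {y \<in> mball x \<epsilon>. d ((S ^^ n) x) ((S ^^ n) y) > \<delta>} > 0"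
  proof (intro exI[of _ \<delta>] conjI \<delta> ballI allI impI)
    fix x and \<epsilon> :: real
    assume x: "x \<in> space N" and \<epsilon>: "\<epsilon> > 0"
    have "d p q \<le> d p x + d x q" using pq x by (intro triangle)
    then obtain c where c: "c \<in> space N" "d x c \<ge> 5 * \<delta>"
      using pq by (cases "d x p \<ge> 5 * \<delta>") (auto simp: \<delta>_def commute)
    \<comment> \<open>The minimum puts \<open>?B\<close> inside the given ball and also within
      \<delta> of \<open>x\<close> when it acts as a target.\<close>
    let ?B = "mball x (min \<epsilon> \<delta>)" and ?C = "mball c \<delta>"
    have B: "?B \<in> sets N" "emeasure N ?B > 0" and C: "?C \<in> sets N" "emeasure N ?C > 0"
      using op op_pos openin_mball centre_in_mball_iff x c(1) \<epsilon> \<delta> by (metis empty_iff min_less_iff_conj)+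
    obtain n where n: "emeasure N ((S ^^ n) -` ?B \<inter> ?B) > 0" "emeasure N ((S ^^ n) -` ?C \<inter> ?B) > 0"
      using isomorphic_common_source[OF de iso B(1) C(1) B(2) C(2)] .
    have Sn: "S ^^ n \<in> measurable N N" using S by (rule measurable_compose_n)
    define a where "a = (S ^^ n) x"
    have a: "a \<in> space N" using measurable_space[OF Sn x] by (simp add: a_def)
    define W where "W = {y \<in> mball x \<epsilon>. d ((S ^^ n) x) ((S ^^ n) y) > \<delta>}"
    \<comment> \<open>\<open>W\<close> must be shown measurable before monotonicity can bound its
      measure from below; it comes from open sets, which regularity makes measurable.\<close>
    have "{z \<in> space N. d a z > \<delta>} = space N - mcball a \<delta>" using a by auto
    then have far: "openin mtopology {z \<in> space N. d a z > \<delta>}"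
      using openin_diff[OF openin_topspace closedin_mcball[of a \<delta>]] by simp
    have "W = ((S ^^ n) -` {z \<in> space N. d a z > \<delta>} \<inter> space N) \<inter> mball x \<epsilon>"
      using measurable_space[OF Sn] by (auto simp: W_def a_def)
    then have W: "W \<in> sets N"
      using measurable_sets[OF Sn op[OF far]] op[OF openin_mball] by auto
    \<comment> \<open>Points \<open>u\<close>, \<open>v\<close> of the two sets outside
      \<open>W\<close> would join \<open>x\<close> to \<open>c\<close> by four steps of length at
      most \<delta>, through their images and \<open>a\<close>.\<close>
    have "(S ^^ n) -` ?B \<inter> ?B \<subseteq> W \<or> (S ^^ n) -` ?C \<inter> ?B \<subseteq> W"
    proof (rule ccontr)
      assume "\<not> ?thesis"
      then obtain u v where u: "u \<in> ?B" "(S ^^ n) u \<in> ?B" "u \<notin> W"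
        and v: "v \<in> ?B" "(S ^^ n) v \<in> ?C" "v \<notin> W" by blast
      have le: "d a ((S ^^ n) u) \<le> \<delta>" "d a ((S ^^ n) v) \<le> \<delta>"
        using u v by (auto simp: W_def a_def)
      have sp: "(S ^^ n) u \<in> space N" "(S ^^ n) v \<in> space N" using u v by auto
      have "d x c \<le> d x ((S ^^ n) u) + d ((S ^^ n) u) a + d a ((S ^^ n) v) + d ((S ^^ n) v) c"
        using triangle[OF x sp(1) c(1)] triangle[OF sp(1) a c(1)] triangle[OF a sp(2) c(1)] by linarith
      moreover have "d x ((S ^^ n) u) < \<delta>" "d ((S ^^ n) v) c < \<delta>"
        using u v by (auto simp: commute)
      ultimately show False using le c(2) \<delta> by (simp add: commute)
    qed
    then have "emeasure N W > 0" using n emeasure_mono[OF _ W] by (metis less_le_trans)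
    then show "\<exists>n. emeasure N {y \<in> mball x \<epsilon>. d ((S ^^ n) x) ((S ^^ n) y) > \<delta>} > 0"
      unfolding W_def by blast
  qed
qed

text \<open>If no time worked, at every positive time one of the two intersections would be null and
  its deviation from the product value at least \<open>c\<close>. The two averaged deviations could
  then not both tend to 0.\<close>

lemma weakly_mixing_doubly_ergodic:
  assumes fin: "finite_measure M" and mp: "measure_preserving_map M T" and wm: "weakly_mixing M T"
  shows "doubly_ergodic M T"
  unfolding doubly_ergodic_def
proof (intro conjI ballI impI)
  interpret finite_measure M by (rule fin)
  show "nonsingular M T" using mp by (simp add: nonsingular_def measure_preserving_map_def)
  fix A B
  assume A: "A \<in> sets M" and B: "B \<in> sets M" and pos: "emeasure M A > 0" "emeasure M B > 0"
  have posm: "measure M A > 0" "measure M B > 0"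
    using pos by (simp_all add: emeasure_eq_measure)
  moreover have "measure M A \<le> measure M (space M)" by (rule bounded_measure)
  ultimately have posX: "measure M (space M) > 0" by linarith
  define h where "h D i = \<bar>measure M ((T ^^ i) -` A \<inter> D) - measure M A * measure M D / measure M (space M)\<bar>"
    for D i
  define c where "c = min (measure M A * measure M A / measure M (space M))
    (measure M A * measure M B / measure M (space M))"
  have c: "c > 0" using posm posX by (simp add: c_def)
  show "\<exists>n>0. emeasure M ((T ^^ n) -` A \<inter> A) > 0 \<and> emeasure M ((T ^^ n) -` A \<inter> B) > 0"
  proof (rule ccontr)
    assume contra: "\<not> ?thesis"
    have ge: "c \<le> h A i + h B i" if "i > 0" for i
    proof -
      have "measure M ((T ^^ i) -` A \<inter> A) = 0 \<or> measure M ((T ^^ i) -` A \<inter> B) = 0"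
        using contra \<open>i > 0\<close> by (metis emeasure_eq_measure ennreal_less_zero_iff zero_less_measure_iff)
      then show ?thesis by (auto simp: h_def c_def min_def posm)
    qed
    have "(\<lambda>n. (\<Sum>i<n. h A i) / real n + (\<Sum>i<n. h B i) / real n) \<longlonglongrightarrow> 0 + 0"
      using wm A B unfolding weakly_mixing_def h_def by (intro tendsto_add) blast+
    moreover have "(\<lambda>n. c * (1 - 1 / real n)) \<longlonglongrightarrow> c * (1 - 0)"
      by (intro tendsto_intros lim_1_over_n)
    moreover have "\<forall>\<^sub>F n in sequentially.
        c * (1 - 1 / real n) \<le> (\<Sum>i<n. h A i) / real n + (\<Sum>i<n. h B i) / real n"
      using eventually_gt_at_top[of 0]
    proof eventually_elim
      case (elim n)
      \<comment> \<open>The bound \<open>ge\<close> says nothing at time 0, so that term is dropped;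
        this is the source of the factor \<open>1 - 1 / real n\<close>.\<close>
      have "c * (real n - 1) = (\<Sum>i\<in>{1..<n}. c)" using elim by (simp add: of_nat_diff)
      also have "\<dots> \<le> (\<Sum>i\<in>{1..<n}. h A i + h B i)" by (intro sum_mono ge) auto
      also have "\<dots> \<le> (\<Sum>i<n. h A i + h B i)"
        by (intro sum_mono2) (auto simp: h_def)
      finally have "c * (real n - 1) / real n \<le> (\<Sum>i<n. h A i + h B i) / real n"
        by (rule divide_right_mono) simp
      then show ?case
        using elim by (simp add: sum.distrib add_divide_distrib diff_divide_distrib right_diff_distrib)
    qed
    ultimately have "c * (1 - 0) \<le> 0 + 0"
      by (intro tendsto_le[OF sequentially_bot])
    with c show False by simp
  qed
qed

theorem proposition2p1:
  fixes M :: "'a measure" and T :: "'a \<Rightarrow> 'a"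
  assumes "lebesgue_space M" and "non_atomic M"
    and "sigma_finite_measure M" and "emeasure M (space M) > 0"
  shows "(nonsingular M T \<and> doubly_ergodic M T \<longrightarrow> weak_measurable_sensitivity TYPE('b) M T) \<and>
         (finite_measure M \<and> measure_preserving_map M T \<and> weakly_mixing M T
            \<longrightarrow> weak_measurable_sensitivity TYPE('b) M T)"
  using assms(2,4) doubly_ergodic_sensitive weakly_mixing_doubly_ergodic by blast

end
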